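(* Let $d<0$ be a square-free integer. The embedding $\phi:\mathbf{SL}(2,\mathbb C)\to\mathbf{Sp}(4,\mathbb R)$ satisfies $$\phi^{-1}(\Gamma_N)=\Lambda_N=\mathbf{SL}(2,\mathcal O_d)(N)$$ for any integer $N\ge1$.
   Context: Transpose is written ${}^tA$. $\mathcal O_d$ is the ring of integers of $\mathbb Q(\sqrt d)$. $\Lambda_N=\mathbf{SL}(2,\mathcal O_d)(N)$ is the principal congruence subgroup: matrices in $\mathbf{SL}(2,\mathcal O_d)$ congruent to the identity modulo the ideal $(N)\subset\mathcal O_d$ (all of $\mathbf{SL}(2,\mathcal O_d)$ if $N=1$). If $d\not\equiv1\pmod 4$ put $\beta=\begin{pmatrix}0&1\\ d&0\end{pmatrix}$, $M=I_4$. If $d=4m+1$ put $\beta=\begin{pmatrix}1&2\\ 2m&-1\end{pmatrix}$, $\sigma=\begin{pmatrix}2&0\\ -1&1\end{pmatrix}$, $M=\begin{pmatrix}\sigma&0\\ 0&2\,{}^t\sigma^{-1}\end{pmatrix}$. Put $N_\beta=\begin{pmatrix}\beta&0\\ 0&{}^t\beta\end{pmatrix}$. $\mathbf{Sp}(4,\mathbb R)$ consists of real block matrices $\begin{pmatrix}A&B\\ C&D\end{pmatrix}$ with ${}^tAD-{}^tCB=I$ and ${}^tAC$, ${}^tBD$ symmetric; $\widehat g=N_\beta gN_\beta^{-1}$ is an involution on it. With $a_i,b_i\in\mathbb R$, $$\phi\begin{pmatrix}a_1+b_1\sqrt d&a_2+b_2\sqrt d\\ a_3+b_3\sqrt d&a_4+b_4\sqrt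 d\end{pmatrix}=M\begin{pmatrix}a_1&b_1&b_2&a_2\\ b_1d&a_1&a_2&b_2d\\ b_3d&a_3&a_4&b_4d\\ a_3&b_3&b_4&a_4\end{pmatrix}M^{-1}.$$ $\Gamma(N)\subset\mathbf{Sp}(4,\mathbb Z)$ is the principal congruence subgroup of level $N$ ($\Gamma(1)=\mathbf{Sp}(4,\mathbb Z)$), and $\Gamma_N=\Gamma(N)\cap\{\widehat\gamma:\gamma\in\Gamma(N)\}$. *)

theory Defs
  imports
    "HOL-Analysis.Analysis"
    "HOL-Computational_Algebra.Polynomial"
    "HOL-Computational_Algebra.Squarefree"
begin

abbreviation sqrt_d :: "int \<Rightarrow> complex" where
  "sqrt_d d \<equiv> csqrt (of_int d)"

definition quadratic_field :: "int \<Rightarrow> complex set" where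
  "quadratic_field d = {of_rat p + of_rat q * sqrt_d d | p q. True}"

definition ring_of_integers :: "int \<Rightarrow> complex set" where
  "ring_of_integers d = {z \<in> quadratic_field d. algebraic_int z}"

definition principal_ideal :: "int \<Rightarrow> int \<Rightarrow> complex set" where
  "principal_ideal d N = {of_int N * z | z. z \<in> ring_of_integers d}"

text \<open>For \<open>d < 0\<close> every complex number is uniquely \<open>a + b * sqrt_d d\<close> with \<open>a\<close> and \<open>b\<close> real;
  the coordinates are \<open>Re z\<close> and the following \<open>b\<close>.\<close>

definition sqrt_coeff :: "int \<Rightarrow> complex \<Rightarrow> real" where
  "sqrt_coeff d z = Im z / sqrt (- of_int d)"

lemma sqrt_coordinates:
  assumes "d < 0"
  shows "z = of_real a + of_real b * sqrt_d d \<longleftrightarrow> a = Re z \<and> b = sqrt_coeff d z"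
proof -
  have "sqrt_d d = \<i> * of_real (sqrt (- of_int d))"
    using assms by simp
  moreover have "sqrt (- of_int d :: real) > 0"
    using assms by simp
  ultimately show ?thesis
    by (auto simp: sqrt_coeff_def complex_eq_iff field_simps)
qed

definition SL2_C :: "(complex^2^2) set" where
  "SL2_C = {A. det A = 1}"

definition SL2_O :: "int \<Rightarrow> (complex^2^2) set" where
  "SL2_O d = {A \<in> SL2_C. \<forall>i j. A $ i $ j \<in> ring_of_integers d}"

definition Lambda :: "int \<Rightarrow> int \<Rightarrow> (complex^2^2) set" where
  "Lambda d N = {A \<in> SL2_O d. \<forall>i j. (A - mat 1) $ i $ j \<in> principal_ideal d N}"

definition block :: "real^2^2 \<Rightarrow> real^2^2 \<Rightarrow> real^2^2 \<Rightarrow> real^2^2 \<Rightarrow> real^4^4" where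
  "block A B C D = vector
    [vector [A$1$1, A$1$2, B$1$1, B$1$2],
     vector [A$2$1, A$2$2, B$2$1, B$2$2],
     vector [C$1$1, C$1$2, D$1$1, D$1$2],
     vector [C$2$1, C$2$2, D$2$1, D$2$2]]"

definition symmetric_matrix :: "'a^'n^'n \<Rightarrow> bool" where
  "symmetric_matrix X \<longleftrightarrow> transpose X = X"

definition Sp4_R :: "(real^4^4) set" where
  "Sp4_R = {block A B C D | A B C D.
     transpose A ** D - transpose C ** B = mat 1 \<and>
     symmetric_matrix (transpose A ** C) \<and> symmetric_matrix (transpose B ** D)}"

definition Sp4_Z :: "(real^4^4) set" where
  "Sp4_Z = {g \<in> Sp4_R. \<forall>i j. g $ i $ j \<in> \<int>}"

definition Gamma :: "int \<Rightarrow> (real^4^4) set" where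
  "Gamma N = {g \<in> Sp4_Z. \<forall>i j. \<exists>k::int. (g - mat 1) $ i $ j = of_int (N * k)}"

text \<open>When \<open>d = 4 * m + 1\<close>, one has \<open>m = (d - 1) div 4\<close>.\<close>

definition beta :: "int \<Rightarrow> real^2^2" where
  "beta d =
    (if d mod 4 = 1 then vector [vector [1, 2], vector [of_int (2 * ((d - 1) div 4)), -1]]
     else vector [vector [0, 1], vector [of_int d, 0]])"

definition sigma :: "real^2^2" where
  "sigma = vector [vector [2, 0], vector [-1, 1]]"

definition M_mat :: "int \<Rightarrow> real^4^4" where
  "M_mat d =
    (if d mod 4 = 1 then block sigma 0 0 (2 *\<^sub>R matrix_inv (transpose sigma)) else mat 1)"

definition N_beta :: "int \<Rightarrow> real^4^4" where
  "N_beta d = block (beta d) 0 0 (transpose (beta d))"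

definition hat :: "int \<Rightarrow> real^4^4 \<Rightarrow> real^4^4" where
  "hat d g = N_beta d ** g ** matrix_inv (N_beta d)"

definition Gamma_hat :: "int \<Rightarrow> int \<Rightarrow> (real^4^4) set" where
  "Gamma_hat d N = Gamma N \<inter> hat d ` Gamma N"

definition phi :: "int \<Rightarrow> complex^2^2 \<Rightarrow> real^4^4" where
  "phi d A =
    (let a1 = Re (A$1$1); b1 = sqrt_coeff d (A$1$1);
         a2 = Re (A$1$2); b2 = sqrt_coeff d (A$1$2);
         a3 = Re (A$2$1); b3 = sqrt_coeff d (A$2$1);
         a4 = Re (A$2$2); b4 = sqrt_coeff d (A$2$2);
         \<delta> = of_int d
     in M_mat d **
        vector [vector [a1,     b1, b2, a2],
                vector [b1 * \<delta>, a1, a2, b2 * \<delta>],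
                vector [b3 * \<delta>, a3, a4, b4 * \<delta>],
                vector [a3,     b3, b4, a4]] **
        matrix_inv (M_mat d))"

end

theory Submission
  imports Defs
begin

text \<open>Writing \<open>\<rho>\<close> for the regular representation of \<open>a + b \<surd>d\<close> on the basis \<open>1, \<surd>d\<close>, the
  matrix inside \<open>phi\<close> is \<open>\<rho>\<close> applied entrywise, conjugated by \<open>diag(I, J)\<close> with \<open>J\<close> the swap;
  so \<open>phi\<close> is multiplicative. Moreover \<open>N_beta\<close> is the image of the scalar matrix \<open>\<surd>d\<close>, hence it
  commutes with \<open>phi d A\<close>, the involution fixes \<open>phi d A\<close>, and only \<open>phi d A \<in> Gamma N\<close> has to be
  decided. The conjugation by \<open>M_mat\<close> replaces the basis \<open>1, \<surd>d\<close> by an integral basis of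
  the ring of integers when \<open>d \<equiv> 1 mod 4\<close>, so that the entries of \<open>phi d A - 1\<close> are integral
  combinations of the \<open>\<int>\<close>-coordinates of the entries of \<open>A - 1\<close>, and conversely.\<close>

subsection \<open>The ring of integers of an imaginary quadratic field\<close>

text \<open>The order Z[sqrt d], in general smaller than the ring of integers. It serves as the
  lattice against which denominators are measured.\<close>

definition quadratic_order :: "int \<Rightarrow> complex set" where
  "quadratic_order d = {of_int u + of_int v * sqrt_d d | u v. True}"

lemma quadratic_order_of_int: "of_int n \<in> quadratic_order d"
  unfolding quadratic_order_def by (rule CollectI, rule exI[of _ n], rule exI[of _ 0]) simp

lemma quadratic_order_add:
  assumes "x \<in> quadratic_order d" "y \<in> quadratic_order d"
  shows "x + y \<in> quadratic_order d"
proof -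
  obtain a b a' b' where "x = of_int a + of_int b * sqrt_d d" "y = of_int a' + of_int b' * sqrt_d d"
    using assms unfolding quadratic_order_def by blast
  then have "x + y = of_int (a + a') + of_int (b + b') * sqrt_d d"
    by (simp add: algebra_simps)
  then show ?thesis unfolding quadratic_order_def by blast
qed

lemma quadratic_order_mult:
  assumes "x \<in> quadratic_order d" "y \<in> quadratic_order d"
  shows "x * y \<in> quadratic_order d"
proof -
  obtain a b a' b' where xy: "x = of_int a + of_int b * sqrt_d d" "y = of_int a' + of_int b' * sqrt_d d"
    using assms unfolding quadratic_order_def by blast
  have "(of_int a + of_int b * s) * (of_int a' + of_int b' * s)
      = of_int (a * a') + of_int (b * b') * s\<^sup>2 + of_int (a * b' + b * a') * s" for s :: complex
    by (simp add: algebra_simps power2_eq_square)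
  from this[of "sqrt_d d"] have "x * y = of_int (a * a' + b * b' * d) + of_int (a * b' + b * a') * sqrt_d d"
    by (simp add: xy)
  then show ?thesis unfolding quadratic_order_def by blast
qed

lemma quadratic_order_power:
  "x \<in> quadratic_order d \<Longrightarrow> x ^ k \<in> quadratic_order d"
  using quadratic_order_of_int[of 1 d] by (induction k) (auto intro: quadratic_order_mult)

lemma quadratic_order_sum:
  "(\<And>i. i \<in> I \<Longrightarrow> f i \<in> quadratic_order d) \<Longrightarrow> sum f I \<in> quadratic_order d"
  using quadratic_order_of_int[of 0 d]
  by (induction I rule: infinite_finite_induct) (auto intro: quadratic_order_add)

lemma quadratic_order_cnj:
  assumes "d < 0" "x \<in> quadratic_order d"
  shows "cnj x \<in> quadratic_order d"
proof -
  obtain a b where "x = of_int a + of_int b * sqrt_d d"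
    using assms unfolding quadratic_order_def by blast
  then have "cnj x = of_int a + of_int (- b) * sqrt_d d"
    using assms(1) by (simp add: complex_eq_iff)
  then show ?thesis unfolding quadratic_order_def by blast
qed

text \<open>For d < 0 the root sqrt d is purely imaginary. This lets a real number found in the
  order be recognised as an integer.\<close>

lemma quadratic_order_Re:
  assumes "d < 0" "x \<in> quadratic_order d"
  shows "Re x \<in> \<int>"
  using assms unfolding quadratic_order_def by auto

section \<open>Bounded denominators and integrality of trace and norm\<close>

lemma quadratic_field_multiple_in_order:
  assumes "z \<in> quadratic_field d"
  obtains D :: int where "D > 0" "of_int D * z \<in> quadratic_order d"
proof -
  obtain p q where z: "z = of_rat p + of_rat q * sqrt_d d"
    using assms unfolding quadratic_field_def by blast
  obtain a b where p: "p = of_int a / of_int b" "b > 0"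
    by (metis quotient_of_div quotient_of_denom_pos surj_pair)
  obtain a' b' where q: "q = of_int a' / of_int b'" "b' > 0"
    by (metis quotient_of_div quotient_of_denom_pos surj_pair)
  have "of_int (b * b') * z = of_int (a * b') + of_int (a' * b) * sqrt_d d"
    using p(2) q(2) by (simp add: z p(1) q(1) of_rat_divide field_simps)
  then have "of_int (b * b') * z \<in> quadratic_order d"
    unfolding quadratic_order_def by blast
  moreover have "b * b' > 0"
    using p q by simp
  ultimately show thesis
    using that by blast
qed

text \<open>A monic equation of degree n writes every power of z as an integral combination of 1,
  ..., z^(n-1), so a common denominator of these serves all powers.\<close>

lemma algebraic_int_powers_bounded_denominator:
  assumes "z \<in> quadratic_field d" "algebraic_int z"
  obtains D :: int where "D > 0" "\<And>k. of_int D * z ^ k \<in> quadratic_order d"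
proof -
  obtain D0 :: int where D0: "D0 > 0" "of_int D0 * z \<in> quadratic_order d"
    using quadratic_field_multiple_in_order assms(1) by blast
  obtain p where p: "lead_coeff p = 1" "\<forall>i. coeff p i \<in> \<int>" "poly p z = 0"
    using assms(2) by (auto elim: algebraic_int.cases)
  define n where "n = degree p"
  define D where "D = D0 ^ n"
  have "of_int D * z ^ k \<in> quadratic_order d" for k
  proof (induction k rule: less_induct)
    case (less k)
    show ?case
    proof (cases "k < n")
      case True
      \<comment> \<open>Once each factor z has absorbed one \<open>D0\<close>, the integer
        \<open>D0 ^ (n - k)\<close> is left over from \<open>D\<close>.\<close>
      then have "of_int D * z ^ k = of_int (D0 ^ (n - k)) * (of_int D0 * z) ^ k"
        by (simp add: D_def power_mult_distrib flip: power_add mult.assoc)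
      then show ?thesis
        using quadratic_order_mult[OF quadratic_order_of_int quadratic_order_power[OF D0(2)]] by (simp only:)
    next
      case False
      have "(\<Sum>i<n. coeff p i * z ^ i) + z ^ n = 0"
        using p by (simp add: poly_altdef n_def lessThan_Suc_atMost[symmetric])
      then have zn: "z ^ n = - (\<Sum>i<n. coeff p i * z ^ i)"
        by (simp add: eq_neg_iff_add_eq_0 add.commute)
      have "z ^ k = z ^ n * z ^ (k - n)"
        using False by (simp flip: power_add)
      then have "of_int D * z ^ k = of_int D * (- (\<Sum>i<n. coeff p i * z ^ i)) * z ^ (k - n)"
        by (simp only: zn mult.assoc)
      \<comment> \<open>Each exponent \<open>i + (k - n)\<close> is below \<open>k\<close>, so the
        induction hypothesis reaches every term.\<close>
      also have "\<dots> = (\<Sum>i<n. (- coeff p i) * (of_int D * z ^ (i + (k - n))))"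
        by (simp add: sum_distrib_left sum_distrib_right sum_negf power_add mult_ac)
      also have "\<dots> \<in> quadratic_order d"
      proof (rule quadratic_order_sum, rule quadratic_order_mult)
        fix i assume "i \<in> {..<n}"
        then show "of_int D * z ^ (i + (k - n)) \<in> quadratic_order d"
          using False by (intro less) auto
        obtain c where "coeff p i = of_int c"
          using p(2) Ints_cases by blast
        then show "- coeff p i \<in> quadratic_order d"
          using quadratic_order_of_int[of "- c" d] by simp
      qed
      finally show ?thesis .
    qed
  qed
  then show thesis
    using that[of D] D0 by (simp add: D_def)
qed

text \<open>With t = a/b in lowest terms, b^k divides c for every k, which is impossible for b >
  1.\<close>

lemma rational_powers_bounded_denominator_imp_int:
  fixes t :: real and c :: int
  assumes "t \<in> \<rat>" "c > 0" "\<And>k. of_int c * t ^ k \<in> \<int>"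
  shows "t \<in> \<int>"
proof -
  obtain a b where ab: "b > 0" "coprime a b" "t = of_int a / of_int b"
    using assms(1) by (auto elim: Rats_cases')
  \<comment> \<open>One exponent suffices: 2^c > c, so b >= 2 would make b^k exceed c.\<close>
  define k where "k = nat c"
  obtain n where "of_int c * t ^ k = of_int n"
    using assms(3) Ints_cases by blast
  then have "real_of_int (c * a ^ k) = of_int (n * b ^ k)"
    using ab(1) by (simp add: ab(3) power_divide field_simps)
  then have "c * a ^ k = n * b ^ k"
    by linarith
  then have "b ^ k dvd c"
    using ab(2) by (metis coprime_commute coprime_dvd_mult_left_iff coprime_power_left_iff coprime_power_right_iff dvd_triv_right)
  then have "b ^ k \<le> c"
    using assms(2) by (rule zdvd_imp_le)
  moreover have "c < b ^ k" if "b \<ge> 2"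
  proof -
    have "c < 2 ^ k"
      using assms(2) of_nat_less_two_power[of k, where 'a=int] by (simp add: k_def)
    also have "\<dots> \<le> b ^ k"
      using that by (intro power_mono) auto
    finally show ?thesis .
  qed
  ultimately have "b = 1"
    using ab(1) by linarith
  then show ?thesis
    by (simp add: ab(3))
qed

lemma of_real_of_rat: "(of_real (of_rat p) :: 'a::real_field) = of_rat p"
  by (cases p) (simp add: of_rat_rat)

lemma quadratic_field_coordinates:
  assumes "d < 0"
  shows "z \<in> quadratic_field d \<longleftrightarrow> Re z \<in> \<rat> \<and> sqrt_coeff d z \<in> \<rat>"
proof
  assume "z \<in> quadratic_field d"
  then obtain p q where "z = of_rat p + of_rat q * sqrt_d d"
    unfolding quadratic_field_def by blast
  then have "z = of_real (of_rat p) + of_real (of_rat q) * sqrt_d d"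
    by (simp add: of_real_of_rat)
  then have "of_rat p = Re z \<and> of_rat q = sqrt_coeff d z"
    using sqrt_coordinates[OF assms] by blast
  then show "Re z \<in> \<rat> \<and> sqrt_coeff d z \<in> \<rat>"
    by (metis Rats_of_rat)
next
  assume "Re z \<in> \<rat> \<and> sqrt_coeff d z \<in> \<rat>"
  then obtain p q where "Re z = of_rat p" "sqrt_coeff d z = of_rat q"
    by (meson Rats_cases)
  then have "z = of_real (of_rat p) + of_real (of_rat q) * sqrt_d d"
    using sqrt_coordinates[OF assms] by metis
  then show "z \<in> quadratic_field d"
    unfolding quadratic_field_def by (auto simp: of_real_of_rat)
qed

lemma norm_sqrt_coordinates:
  assumes "d < 0"
  shows "z * cnj z = of_real ((Re z)\<^sup>2 - of_int d * (sqrt_coeff d z)\<^sup>2)"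
  using assms by (simp add: complex_eq_iff sqrt_coeff_def power2_eq_square field_simps)

text \<open>The trace and the norm of an integer of the field are integers because all their powers have
  a common denominator.\<close>

lemma ring_of_integers_trace_norm:
  assumes "d < 0"
  shows "z \<in> ring_of_integers d \<longleftrightarrow> Re z \<in> \<rat> \<and> sqrt_coeff d z \<in> \<rat> \<and>
    2 * Re z \<in> \<int> \<and> (Re z)\<^sup>2 - of_int d * (sqrt_coeff d z)\<^sup>2 \<in> \<int>"
proof
  define n where "n = (Re z)\<^sup>2 - of_int d * (sqrt_coeff d z)\<^sup>2"
  assume "z \<in> ring_of_integers d"
  then have z: "z \<in> quadratic_field d" "algebraic_int z"
    unfolding ring_of_integers_def by auto
  then have rat: "Re z \<in> \<rat>" "sqrt_coeff d z \<in> \<rat>"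
    using quadratic_field_coordinates[OF assms] by auto
  obtain D where D: "D > 0" "\<And>k. of_int D * z ^ k \<in> quadratic_order d"
    using algebraic_int_powers_bounded_denominator[OF z] by blast
  have D': "of_int D * cnj z ^ k \<in> quadratic_order d" for k
    using quadratic_order_cnj[OF assms D(2)[of k]] by simp
  \<comment> \<open>Each binomial term contains a power of z and a power of its conjugate, and each
    of the two needs its own factor \<open>D\<close>; hence \<open>D\<^sup>2\<close>.\<close>
  have trace_powers: "of_int (D\<^sup>2) * (2 * Re z) ^ k \<in> \<int>" for k
  proof -
    have "of_real (of_int (D\<^sup>2) * (2 * Re z) ^ k) = of_int (D\<^sup>2) * (z + cnj z) ^ k"
      by (simp add: complex_add_cnj)
    also have "\<dots> = (\<Sum>i\<le>k. of_int (int (k choose i)) * ((of_int D * z ^ i) * (of_int D * cnj z ^ (k - i))))"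
      unfolding binomial_ring by (simp add: sum_distrib_left power2_eq_square algebra_simps)
    also have "\<dots> \<in> quadratic_order d"
      by (intro quadratic_order_sum quadratic_order_mult quadratic_order_of_int D D')
    finally show ?thesis
      using quadratic_order_Re[OF assms] by (metis Re_complex_of_real)
  qed
  have norm_powers: "of_int (D\<^sup>2) * n ^ k \<in> \<int>" for k
  proof -
    have "of_real (of_int (D\<^sup>2) * n ^ k) = of_int (D\<^sup>2) * (z * cnj z) ^ k"
      unfolding norm_sqrt_coordinates[OF assms] n_def[symmetric] by simp
    also have "\<dots> = (of_int D * z ^ k) * (of_int D * cnj z ^ k)"
      by (simp add: power_mult_distrib power2_eq_square mult_ac)
    also have "\<dots> \<in> quadratic_order d"
      by (intro quadratic_order_mult D D')
    finally show ?thesis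
      using quadratic_order_Re[OF assms] by (metis Re_complex_of_real)
  qed
  have "2 * Re z \<in> \<rat>" "n \<in> \<rat>" "D\<^sup>2 > 0"
    using rat D(1) by (auto simp: n_def)
  then have "2 * Re z \<in> \<int>" "n \<in> \<int>"
    using rational_powers_bounded_denominator_imp_int trace_powers norm_powers by blast+
  with rat show "Re z \<in> \<rat> \<and> sqrt_coeff d z \<in> \<rat> \<and>
    2 * Re z \<in> \<int> \<and> (Re z)\<^sup>2 - of_int d * (sqrt_coeff d z)\<^sup>2 \<in> \<int>"
    by (simp add: n_def)
next
  assume *: "Re z \<in> \<rat> \<and> sqrt_coeff d z \<in> \<rat> \<and>
    2 * Re z \<in> \<int> \<and> (Re z)\<^sup>2 - of_int d * (sqrt_coeff d z)\<^sup>2 \<in> \<int>"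
  have "algebraic_int z"
  proof
    \<comment> \<open>z is a root of X^2 - (trace) X + norm, whose coefficients are integers by
      assumption.\<close>
    show "poly [:z * cnj z, - (z + cnj z), 1:] z = 0"
      by (simp add: distrib_left del: complex_add_cnj)
    have "z * cnj z \<in> \<int>" "z + cnj z \<in> \<int>"
      using * unfolding norm_sqrt_coordinates[OF assms] complex_add_cnj by (auto elim!: Ints_cases simp del: of_real_diff of_real_mult)
    then show "\<forall>i. coeff [:z * cnj z, - (z + cnj z), 1:] i \<in> \<int>"
      using Ints_minus[of "z + cnj z"] by (auto simp: coeff_pCons split: nat.splits)
  qed simp
  then show "z \<in> ring_of_integers d"
    using * quadratic_field_coordinates[OF assms] unfolding ring_of_integers_def by blast
qed

section \<open>Integral coordinates for square-free d\<close>

text \<open>With r = a/b in lowest terms, b^2 divides d * a^2 and is coprime to a^2. So b^2 divides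
  d, and square-freeness makes b a unit.\<close>

lemma squarefree_mult_square_int:
  fixes r :: real and d :: int
  assumes "squarefree d" "r \<in> \<rat>" "of_int d * r\<^sup>2 \<in> \<int>"
  shows "r \<in> \<int>"
proof -
  obtain a b where ab: "b > 0" "coprime a b" "r = of_int a / of_int b"
    using assms(2) by (auto elim: Rats_cases')
  obtain n where "of_int d * r\<^sup>2 = of_int n"
    using assms(3) Ints_cases by blast
  then have "real_of_int (d * a\<^sup>2) = of_int (n * b\<^sup>2)"
    using ab(1) by (simp add: ab(3) power_divide field_simps)
  then have "d * a\<^sup>2 = n * b\<^sup>2"
    by linarith
  then have "b\<^sup>2 dvd d"
    using ab(2) by (metis coprime_commute coprime_dvd_mult_left_iff coprime_power_left_iff coprime_power_right_iff dvd_triv_right)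
  then have "b dvd 1"
    using assms(1) squarefreeD by blast
  then show ?thesis
    using ab by simp
qed

lemma square_mod_4: "(x::int)\<^sup>2 mod 4 = (if even x then 0 else 1)"
proof (cases "even x")
  case True
  then obtain y where "x = 2 * y" by blast
  then show ?thesis by (simp add: power2_eq_square)
next
  case False
  then obtain y where "x = 2 * y + 1" using oddE by blast
  then have "x\<^sup>2 = 4 * (y\<^sup>2 + y) + 1" by (simp add: power2_eq_square algebra_simps)
  then show ?thesis using False by presburger
qed

text \<open>Squares are 0 or 1 mod 4 and square-freeness excludes 4 | d; the remaining residues are
  checked one by one. Here a and b stand for the doubled coordinates of an element of norm
  n.\<close>

lemma norm_parity:
  fixes a b d n :: int
  assumes "squarefree d" "a\<^sup>2 - d * b\<^sup>2 = 4 * n"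
  shows "if d mod 4 = 1 then even (a - b) else even a \<and> even b"
proof -
  have "\<not> 4 dvd d"
    using assms(1) squarefreeD[of d 2] by auto
  then have d: "d mod 4 \<in> {1, 2, 3}" by auto presburger
  have "(a\<^sup>2 mod 4 - (d mod 4) * (b\<^sup>2 mod 4) mod 4) mod 4 = (a\<^sup>2 - d * b\<^sup>2) mod 4"
    by (simp only: mod_mult_eq mod_diff_eq)
  also have "\<dots> = 0"
    using assms(2) by simp
  finally show ?thesis
    using d unfolding square_mod_4 by (auto split: if_splits)
qed

text \<open>With b = \<open>sqrt_coeff d z\<close> one has z = (Re z - b) + 2b * (1 + sqrt d)/2. For
  d = 1 mod 4 the conditions are thus integrality in the basis 1, (1 + sqrt d)/2.\<close>

lemma ring_of_integers_coordinates:
  assumes "d < 0" "squarefree d"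
  shows "z \<in> ring_of_integers d \<longleftrightarrow>
    (if d mod 4 = 1 then 2 * sqrt_coeff d z \<in> \<int> \<and> Re z - sqrt_coeff d z \<in> \<int>
     else Re z \<in> \<int> \<and> sqrt_coeff d z \<in> \<int>)" (is "_ = ?R")
proof
  define b where "b = sqrt_coeff d z"
  assume "z \<in> ring_of_integers d"
  then have *: "b \<in> \<rat>" "2 * Re z \<in> \<int>" "(Re z)\<^sup>2 - of_int d * b\<^sup>2 \<in> \<int>"
    using ring_of_integers_trace_norm[OF assms(1)] by (auto simp: b_def)
  obtain x n where xn: "2 * Re z = of_int x" "(Re z)\<^sup>2 - of_int d * b\<^sup>2 = of_int n"
    using * Ints_cases by metis
  \<comment> \<open>Four times the norm, solved for the second coordinate: d * (2b)^2 is an integer,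
    so 2b is one by square-freeness.\<close>
  have eq: "of_int d * (2 * b)\<^sup>2 = (2 * Re z)\<^sup>2 - 4 * of_int n"
    by (simp add: power2_eq_square algebra_simps flip: xn(2))
  moreover have "(2 * Re z)\<^sup>2 - 4 * real_of_int n \<in> \<int>"
    unfolding xn(1) by simp
  ultimately have "2 * b \<in> \<int>"
    using *(1) squarefree_mult_square_int[OF assms(2), of "2 * b"] by simp
  then obtain y where y: "2 * b = of_int y"
    using Ints_cases by blast
  have "real_of_int (x\<^sup>2 - d * y\<^sup>2) = of_int (4 * n)"
    using eq unfolding y xn(1) by simp
  then have "x\<^sup>2 - d * y\<^sup>2 = 4 * n"
    by linarith
  note par = norm_parity[OF assms(2) this]
  have half: "Re z = of_int x / 2" "b = of_int y / 2"
    using y xn by auto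
  have half_int: "real_of_int k / 2 \<in> \<int>" if "even k" for k
    using that by auto
  show ?R
  proof (cases "d mod 4 = 1")
    case True
    then have "Re z - b \<in> \<int>"
      using half_int[of "x - y"] par by (simp add: half diff_divide_distrib)
    with True y show ?thesis
      by (simp add: b_def)
  next
    case False
    then show ?thesis
      using half_int[of x] half_int[of y] par unfolding b_def[symmetric] half by simp
  qed
next
  define b where "b = sqrt_coeff d z"
  assume R: ?R
  show "z \<in> ring_of_integers d"
  proof (cases "d mod 4 = 1")
    case True
    then obtain m where m: "d = 4 * m + 1"
      by (metis mult_div_mod_eq)
    obtain x y where "2 * b = of_int x" "Re z - b = of_int y"
      using R True Ints_cases unfolding b_def[symmetric] by metis
    then have xy: "b = of_int x / 2" "Re z = of_int y + of_int x / 2"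
      by auto
    \<comment> \<open>The norm of y + x * (1 + sqrt d)/2, where (1 - d)/4 = -m.\<close>
    have "(Re z)\<^sup>2 - of_int d * b\<^sup>2 = of_int (y\<^sup>2 + x * y - m * x\<^sup>2)"
      by (simp add: xy m power2_eq_square field_simps)
    moreover have "2 * Re z = of_int (2 * y + x)"
      by (simp add: xy)
    moreover have "b \<in> \<rat>" "Re z \<in> \<rat>"
      by (simp_all add: xy)
    ultimately show ?thesis
      unfolding ring_of_integers_trace_norm[OF assms(1)] b_def[symmetric] by (metis Ints_of_int)
  next
    case False
    with R show ?thesis
      unfolding ring_of_integers_trace_norm[OF assms(1)] by (auto elim!: Ints_cases)
  qed
qed

section \<open>Congruences modulo N in coordinates\<close>

text \<open>The congruence condition in the form used by \<open>Gamma\<close>, as a predicate on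
  reals so that it fits coordinates and matrix entries alike.\<close>

definition int_multiple :: "int \<Rightarrow> real \<Rightarrow> bool" where
  "int_multiple N r \<longleftrightarrow> (\<exists>k::int. r = of_int (N * k))"

lemma int_multiple_add: "int_multiple N x \<Longrightarrow> int_multiple N y \<Longrightarrow> int_multiple N (x + y)"
  unfolding int_multiple_def by (metis distrib_left of_int_add)

lemma int_multiple_diff: "int_multiple N x \<Longrightarrow> int_multiple N y \<Longrightarrow> int_multiple N (x - y)"
  unfolding int_multiple_def by (metis right_diff_distrib of_int_diff)

lemma int_multiple_mult: "int_multiple N x \<Longrightarrow> int_multiple N (of_int n * x)"
  unfolding int_multiple_def by (metis mult.left_commute of_int_mult)

lemma int_multiple_imp_Ints: "int_multiple N x \<Longrightarrow> x \<in> \<int>"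
  unfolding int_multiple_def by (metis Ints_of_int)

lemma int_multiple_scale:
  "N \<noteq> 0 \<Longrightarrow> int_multiple N (of_int N * r) \<longleftrightarrow> r \<in> \<int>"
  unfolding int_multiple_def by (auto elim!: Ints_cases)

text \<open>Division by N scales both coordinates and turns membership in the ideal into membership
  in the ring of integers.\<close>

lemma principal_ideal_coordinates:
  assumes "d < 0" "squarefree d" "N \<noteq> 0"
  shows "z \<in> principal_ideal d N \<longleftrightarrow>
    (if d mod 4 = 1
     then int_multiple N (2 * sqrt_coeff d z) \<and> int_multiple N (Re z - sqrt_coeff d z)
     else int_multiple N (Re z) \<and> int_multiple N (sqrt_coeff d z))"
proof -
  define w where "w = z / of_int N"
  have z: "z = of_int N * w"
    using assms(3) by (simp add: w_def)
  have coord: "Re z = of_int N * Re w" "sqrt_coeff d z = of_int N * sqrt_coeff d w"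
    by (simp_all add: z sqrt_coeff_def)
  have "z \<in> principal_ideal d N \<longleftrightarrow> w \<in> ring_of_integers d"
    using assms(3) unfolding principal_ideal_def z by auto
  moreover have "2 * sqrt_coeff d z = of_int N * (2 * sqrt_coeff d w)"
    "Re z - sqrt_coeff d z = of_int N * (Re w - sqrt_coeff d w)"
    by (simp_all add: coord algebra_simps)
  ultimately show ?thesis
    using ring_of_integers_coordinates[OF assms(1,2)] int_multiple_scale[OF assms(3)] coord by metis
qed

lemma sqrt_coeff_simps [simp]:
  "sqrt_coeff d (z + w) = sqrt_coeff d z + sqrt_coeff d w"
  "sqrt_coeff d (z - w) = sqrt_coeff d z - sqrt_coeff d w"
  "sqrt_coeff d 0 = 0" "sqrt_coeff d 1 = 0"
  by (simp_all add: sqrt_coeff_def add_divide_distrib diff_divide_distrib)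

lemma sqrt_coordinates_mult:
  assumes "d < 0"
  shows "Re (z * w) = Re z * Re w + of_int d * (sqrt_coeff d z * sqrt_coeff d w)"
    and "sqrt_coeff d (z * w) = Re z * sqrt_coeff d w + sqrt_coeff d z * Re w"
  using assms by (simp_all add: sqrt_coeff_def field_simps)

text \<open>The complex equation det A = 1 splits into its two coordinates; the symplectic condition
  is derived from these relations.\<close>

lemma SL2_C_sqrt_coordinates:
  assumes "d < 0" "A \<in> SL2_C"
  shows "Re (A$1$1) * Re (A$2$2) + of_int d * (sqrt_coeff d (A$1$1) * sqrt_coeff d (A$2$2))
       - (Re (A$1$2) * Re (A$2$1) + of_int d * (sqrt_coeff d (A$1$2) * sqrt_coeff d (A$2$1))) = 1"
    and "Re (A$1$1) * sqrt_coeff d (A$2$2) + sqrt_coeff d (A$1$1) * Re (A$2$2)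
       - (Re (A$1$2) * sqrt_coeff d (A$2$1) + sqrt_coeff d (A$1$2) * Re (A$2$1)) = 0"
proof -
  have "A$1$1 * A$2$2 - A$1$2 * A$2$1 = 1"
    using assms(2) by (simp add: SL2_C_def det_2)
  from arg_cong[OF this, of Re] arg_cong[OF this, of "sqrt_coeff d"]
  show "Re (A$1$1) * Re (A$2$2) + of_int d * (sqrt_coeff d (A$1$1) * sqrt_coeff d (A$2$2))
       - (Re (A$1$2) * Re (A$2$1) + of_int d * (sqrt_coeff d (A$1$2) * sqrt_coeff d (A$2$1))) = 1"
    "Re (A$1$1) * sqrt_coeff d (A$2$2) + sqrt_coeff d (A$1$1) * Re (A$2$2)
       - (Re (A$1$2) * sqrt_coeff d (A$2$1) + sqrt_coeff d (A$1$2) * Re (A$2$1)) = 0"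
    by (simp_all add: sqrt_coordinates_mult[OF assms(1)] del: times_complex.sel)
qed

subsection \<open>The embedding in coordinates\<close>

lemma vector_4 [simp]:
  "(vector [x, y, z, w] :: 'a::zero^4) $ 1 = x"
  "(vector [x, y, z, w] :: 'a::zero^4) $ 2 = y"
  "(vector [x, y, z, w] :: 'a::zero^4) $ 3 = z"
  "(vector [x, y, z, w] :: 'a::zero^4) $ 4 = w"
  unfolding vector_def by simp_all

text \<open>\<open>matrix_inv\<close> is a Hilbert choice; uniqueness of two-sided inverses pins it
  down.\<close>

lemma matrix_inv_eqI:
  assumes "A ** B = mat 1" "B ** A = mat 1"
  shows "matrix_inv A = B"
proof -
  have "A ** matrix_inv A = mat 1 \<and> matrix_inv A ** A = mat 1"
    unfolding matrix_inv_def by (rule someI[of _ B]) (use assms in simp)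
  then have "matrix_inv A = matrix_inv A ** (A ** B)"
    using assms by simp
  also have "\<dots> = B"
    using \<open>A ** matrix_inv A = mat 1 \<and> matrix_inv A ** A = mat 1\<close> by (simp add: matrix_mul_assoc)
  finally show ?thesis .
qed

lemmas matrix_entry_simps = vec_eq_iff forall_2 forall_4 sum_2 sum_4 matrix_matrix_mult_def
  mat_def transpose_def block_def

lemma sigma_inverse:
  "matrix_inv sigma = vector [vector [1/2, 0], vector [1/2, 1]]"
  "matrix_inv (transpose sigma) = vector [vector [1/2, 1/2], vector [0, 1]]"
  by (rule matrix_inv_eqI; simp add: matrix_entry_simps sigma_def)+

lemma M_mat_inverse:
  "matrix_inv (M_mat d) = (if d mod 4 = 1
     then block (matrix_inv sigma) 0 0 ((1/2) *\<^sub>R transpose sigma) else mat 1)"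
  by (rule matrix_inv_eqI; simp add: M_mat_def sigma_inverse; simp add: matrix_entry_simps sigma_def)

lemma of_int_mod_4_eq_1:
  assumes "d mod 4 = 1"
  shows "real_of_int d = 4 * of_int ((d - 1) div 4) + 1"
proof -
  have "d = 4 * ((d - 1) div 4) + 1"
    using assms by presburger
  then show ?thesis
    by (metis of_int_1 of_int_add of_int_mult of_int_numeral)
qed

text \<open>The halves from the inverse of \<open>sigma\<close> cancel: for d = 4m + 1 every entry
  is an integral combination of some 2y and x - y. All later facts about \<open>phi\<close> are read
  off from these blocks.\<close>

lemma phi_eq:
  fixes A :: "complex^2^2" and d :: int
  defines "m \<equiv> of_int ((d - 1) div 4)"
    and "x1 \<equiv> Re (A$1$1)" and "y1 \<equiv> sqrt_coeff d (A$1$1)"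
    and "x2 \<equiv> Re (A$1$2)" and "y2 \<equiv> sqrt_coeff d (A$1$2)"
    and "x3 \<equiv> Re (A$2$1)" and "y3 \<equiv> sqrt_coeff d (A$2$1)"
    and "x4 \<equiv> Re (A$2$2)" and "y4 \<equiv> sqrt_coeff d (A$2$2)"
  shows "d mod 4 = 1 \<Longrightarrow> phi d A = block
      (vector [vector [x1 + y1, 2 * y1], vector [2 * m * y1, x1 - y1]])
      (vector [vector [2 * y2, x2 - y2], vector [x2 - y2, 2 * m * y2 + y2 - x2]])
      (vector [vector [2 * m * y3 + y3 + x3, x3 + y3], vector [x3 + y3, 2 * y3]])
      (vector [vector [x4 + y4, 2 * m * y4], vector [2 * y4, x4 - y4]])" (is "_ \<Longrightarrow> ?one")
    and "d mod 4 \<noteq> 1 \<Longrightarrow> phi d A = block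
      (vector [vector [x1, y1], vector [of_int d * y1, x1]])
      (vector [vector [y2, x2], vector [x2, of_int d * y2]])
      (vector [vector [of_int d * y3, x3], vector [x3, y3]])
      (vector [vector [x4, of_int d * y4], vector [y4, x4]])" (is "_ \<Longrightarrow> ?other")
proof -
  note defs = x1_def y1_def x2_def y2_def x3_def y3_def x4_def y4_def
  show ?one if d: "d mod 4 = 1"
  proof -
    have "real_of_int d = 4 * m + 1"
      using of_int_mod_4_eq_1[OF d] unfolding m_def .
    then show ?thesis
      unfolding phi_def Let_def M_mat_inverse defs[symmetric]
      by (simp add: d M_mat_def sigma_inverse) (simp add: matrix_entry_simps sigma_def algebra_simps)
  qed
  show ?other if d: "d mod 4 \<noteq> 1"
    unfolding phi_def Let_def M_mat_inverse defs[symmetric]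
    by (simp add: d M_mat_def) (simp add: matrix_entry_simps)
qed

section \<open>Symplecticity, injectivity and multiplicativity\<close>

lemma block_in_Sp4_R:
  "transpose A ** D - transpose C ** B = mat 1 \<Longrightarrow> symmetric_matrix (transpose A ** C) \<Longrightarrow>
   symmetric_matrix (transpose B ** D) \<Longrightarrow> block A B C D \<in> Sp4_R"
  unfolding Sp4_R_def by blast

text \<open>The two symmetry conditions are polynomial identities, while the four entries of the
  remaining condition follow from the two coordinate equations of det A = 1.\<close>

lemma phi_in_Sp4_R:
  assumes "d < 0" "A \<in> SL2_C"
  shows "phi d A \<in> Sp4_R"
proof (cases "d mod 4 = 1")
  case True
  have d: "real_of_int d = 4 * of_int ((d - 1) div 4) + 1"
    using of_int_mod_4_eq_1[OF True] .
  define m where "m = real_of_int ((d - 1) div 4)"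
  note SL2 = SL2_C_sqrt_coordinates[OF assms, unfolded d, folded m_def]
  show ?thesis
    unfolding phi_eq(1)[OF True] m_def[symmetric]
  proof (rule block_in_Sp4_R, goal_cases)
    case 1
    show ?case
      by (simp add: matrix_entry_simps; intro conjI; insert SL2; algebra)
  qed (simp_all add: symmetric_matrix_def matrix_entry_simps algebra_simps)
next
  case False
  note SL2 = SL2_C_sqrt_coordinates[OF assms]
  show ?thesis
    unfolding phi_eq(2)[OF False]
  proof (rule block_in_Sp4_R, goal_cases)
    case 1
    show ?case
      by (simp add: matrix_entry_simps; intro conjI; insert SL2; algebra)
  qed (simp_all add: symmetric_matrix_def matrix_entry_simps algebra_simps)
qed

lemma matrix_eq_of_sqrt_coordinates:
  assumes "d < 0" "\<And>i j. Re (A$i$j) = Re (B$i$j)" "\<And>i j. sqrt_coeff d (A$i$j) = sqrt_coeff d (B$i$j)"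
  shows "A = B"
  using assms by (simp add: vec_eq_iff complex_eq_iff sqrt_coeff_def)

text \<open>Each block determines both coordinates of the corresponding entry of A.\<close>

lemma phi_inj:
  assumes "d < 0"
  shows "inj (phi d)"
proof (rule injI)
  fix A B assume eq: "phi d A = phi d B"
  have "(\<forall>i j. Re (A$i$j) = Re (B$i$j)) \<and> (\<forall>i j. sqrt_coeff d (A$i$j) = sqrt_coeff d (B$i$j))"
  proof (cases "d mod 4 = 1")
    case True
    show ?thesis
      using eq unfolding phi_eq(1)[OF True] by (simp add: matrix_entry_simps)
  next
    case False
    show ?thesis
      using eq unfolding phi_eq(2)[OF False] by (simp add: matrix_entry_simps)
  qed
  then show "A = B"
    using matrix_eq_of_sqrt_coordinates[OF assms] by blast
qed

lemma phi_mult: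
  assumes "d < 0"
  shows "phi d (A ** B) = phi d A ** phi d B"
proof -
  have entry: "(A ** B)$i$j = A$i$1 * B$1$j + A$i$2 * B$2$j" for i j
    by (simp add: matrix_matrix_mult_def sum_2)
  show ?thesis
  proof (cases "d mod 4 = 1")
    case True
    have d: "real_of_int d = 4 * of_int ((d - 1) div 4) + 1"
      using of_int_mod_4_eq_1[OF True] .
    show ?thesis
      \<comment> \<open>The product rule introduces \<open>of_int d\<close> while
        \<open>phi_eq\<close> speaks of m; substituting d = 4m + 1 makes both sides polynomials in
        m.\<close>
      unfolding phi_eq(1)[OF True] entry plus_complex.sel sqrt_coeff_simps
        sqrt_coordinates_mult[OF assms] d
      by (simp add: matrix_entry_simps algebra_simps)
  next
    case False
    show ?thesis
      unfolding phi_eq(2)[OF False] entry plus_complex.sel sqrt_coeff_simps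
        sqrt_coordinates_mult[OF assms]
      by (simp add: matrix_entry_simps algebra_simps)
  qed
qed

section \<open>The involution fixes the image of the embedding\<close>

lemma N_beta_commute: "N_beta d ** phi d A = phi d A ** N_beta d"
proof (cases "d mod 4 = 1")
  case True
  then show ?thesis
    unfolding phi_eq(1)[OF True] by (simp add: N_beta_def beta_def matrix_entry_simps algebra_simps)
next
  case False
  then show ?thesis
    unfolding phi_eq(2)[OF False] by (simp add: N_beta_def beta_def matrix_entry_simps algebra_simps)
qed

text \<open>This mirrors (sqrt d)^2 = d and exhibits the inverse of \<open>N_beta d\<close> as its
  multiple by 1/d.\<close>

lemma N_beta_square: "N_beta d ** N_beta d = of_int d *\<^sub>R mat 1"
proof (cases "d mod 4 = 1")
  case True
  have "real_of_int d = 4 * of_int ((d - 1) div 4) + 1"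
    using of_int_mod_4_eq_1[OF True] .
  with True show ?thesis
    by (simp add: N_beta_def beta_def matrix_entry_simps)
next
  case False
  then show ?thesis
    by (simp add: N_beta_def beta_def matrix_entry_simps)
qed

lemma hat_phi:
  assumes "d \<noteq> 0"
  shows "hat d (phi d A) = phi d A"
proof -
  have "N_beta d ** ((1 / of_int d) *\<^sub>R N_beta d) = mat 1"
    using assms unfolding matrix_scalar_ac scalar_matrix_assoc[symmetric] N_beta_square by simp
  moreover from this have "((1 / of_int d) *\<^sub>R N_beta d) ** N_beta d = mat 1"
    using matrix_left_right_inverse by blast
  ultimately have "N_beta d ** matrix_inv (N_beta d) = mat 1"
    using matrix_inv_eqI by metis
  then show ?thesis
    unfolding hat_def N_beta_commute by (simp flip: matrix_mul_assoc)
qed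

text \<open>A fixed point of the involution lying in \<open>Gamma N\<close> is its own preimage
  under \<open>hat d\<close>, so it lies in the conjugate group as well.\<close>

lemma phi_in_Gamma_hat:
  assumes "d \<noteq> 0"
  shows "phi d A \<in> Gamma_hat d N \<longleftrightarrow> phi d A \<in> Gamma N"
  unfolding Gamma_hat_def using hat_phi[OF assms, of A] by (metis IntE IntI imageI)

section \<open>The congruence conditions on both sides\<close>

text \<open>Entries that differ from 0 or 1 by a multiple of N are integers, so integrality comes
  with the congruence.\<close>

lemma Gamma_iff:
  "g \<in> Gamma N \<longleftrightarrow> g \<in> Sp4_R \<and> (\<forall>i j. int_multiple N ((g - mat 1) $ i $ j))"
proof -
  have "g $ i $ j \<in> \<int>" if "int_multiple N ((g - mat 1) $ i $ j)" for i j
  proof -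
    have "g $ i $ j = (g - mat 1) $ i $ j + mat 1 $ i $ j"
      by simp
    also have "\<dots> \<in> \<int>"
      using int_multiple_imp_Ints[OF that] by (intro Ints_add) (auto simp: mat_def)
    finally show ?thesis .
  qed
  then show ?thesis
    unfolding Gamma_def Sp4_Z_def int_multiple_def[symmetric] by blast
qed

text \<open>The block formulas are linear in the coordinates and send 1 to 1. They apply to A - 1
  too, although it need not have determinant 1.\<close>

lemma phi_minus_one:
  "phi d (A - mat 1) = phi d A - mat 1"
proof (cases "d mod 4 = 1")
  case True
  show ?thesis
    unfolding phi_eq(1)[OF True] by (simp add: matrix_entry_simps)
next
  case False
  show ?thesis
    unfolding phi_eq(2)[OF False] by (simp add: matrix_entry_simps)
qed

text \<open>The entries of a block and the integral-basis coordinates of the matching entry of X are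
  integral combinations of each other, so divisibility by N passes both ways.\<close>

lemma phi_entries_int_multiple:
  assumes "d < 0" "squarefree d" "N \<noteq> 0"
  shows "(\<forall>i j. int_multiple N (phi d X $ i $ j)) \<longleftrightarrow> (\<forall>i j. X $ i $ j \<in> principal_ideal d N)"
proof (cases "d mod 4 = 1")
  case True
  define m where "m = (d - 1) div 4"
  have "int_multiple N (x + y)" "int_multiple N (2 * of_int m * y)"
    "int_multiple N (2 * of_int m * y + y - x)" "int_multiple N (2 * of_int m * y + y + x)"
    if xy: "int_multiple N (2 * y)" "int_multiple N (x - y)" for x y
  proof -
    show 1: "int_multiple N (x + y)"
      using int_multiple_add[OF xy(2) xy(1)] by (simp add: algebra_simps)
    show 2: "int_multiple N (2 * of_int m * y)"
      using int_multiple_mult[OF xy(1), of m] by (simp add: algebra_simps)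
    show "int_multiple N (2 * of_int m * y + y - x)"
      using int_multiple_diff[OF 2 xy(2)] by (simp add: algebra_simps)
    show "int_multiple N (2 * of_int m * y + y + x)"
      using int_multiple_add[OF 2 1] by (simp add: algebra_simps)
  qed
  \<comment> \<open>The lower left block does not display x - y; there it is recovered from x + y
    and 2y.\<close>
  moreover have "int_multiple N (x - y)" if "int_multiple N (x + y)" "int_multiple N (2 * y)" for x y
    using int_multiple_diff[OF that] by (simp add: algebra_simps)
  ultimately show ?thesis
    unfolding phi_eq(1)[OF True] principal_ideal_coordinates[OF assms] m_def[symmetric]
    by (simp add: True forall_2 forall_4 block_def) blast
next
  case False
  then show ?thesis
    unfolding phi_eq(2)[OF False] principal_ideal_coordinates[OF assms]
    by (auto simp: forall_2 forall_4 block_def intro: int_multiple_mult)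
qed

text \<open>The ideal lies in the ring of integers and the identity has entries 0 and 1. This
  supplies the integrality contained in \<open>Lambda\<close>.\<close>

lemma congruent_mat_1_imp_ring_of_integers:
  assumes "d < 0" "squarefree d" "N \<noteq> 0" "(A - mat 1) $ i $ j \<in> principal_ideal d N"
  shows "A $ i $ j \<in> ring_of_integers d"
proof -
  define x where "x = (A - mat 1) $ i $ j"
  have A: "A $ i $ j = x + mat 1 $ i $ j"
    by (simp add: x_def)
  show ?thesis
    using assms(4) unfolding x_def[symmetric]
      principal_ideal_coordinates[OF assms(1-3)] ring_of_integers_coordinates[OF assms(1,2)] A
    by (auto dest!: int_multiple_imp_Ints simp: mat_def distrib_left split: if_splits)
      (metis Ints_1 Ints_add add.commute add_diff_eq)
qed

theorem proposition2p10:
  fixes d N :: int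
  assumes "d < 0" and "squarefree d" and "N \<ge> 1"
  shows "phi d ` SL2_C \<subseteq> Sp4_R
    \<and> inj_on (phi d) SL2_C
    \<and> (\<forall>A\<in>SL2_C. \<forall>B\<in>SL2_C. phi d (A ** B) = phi d A ** phi d B)
    \<and> {A \<in> SL2_C. phi d A \<in> Gamma_hat d N} = Lambda d N"
proof (intro conjI)
  have nz: "d \<noteq> 0" "N \<noteq> 0"
    using assms by auto
  show "phi d ` SL2_C \<subseteq> Sp4_R"
    using phi_in_Sp4_R[OF assms(1)] by blast
  show "inj_on (phi d) SL2_C"
    using phi_inj[OF assms(1)] by (rule inj_on_subset) simp
  show "\<forall>A\<in>SL2_C. \<forall>B\<in>SL2_C. phi d (A ** B) = phi d A ** phi d B"
    using phi_mult[OF assms(1)] by blast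
  have "phi d A \<in> Gamma_hat d N \<longleftrightarrow> A \<in> Lambda d N" if A: "A \<in> SL2_C" for A
  proof -
    \<comment> \<open>Invariance under the involution reduces to \<open>Gamma N\<close>; its
      congruences concern the entries of \<open>phi d (A - mat 1)\<close>, which translate into the
      ideal, and \<open>phi d A\<close> is already symplectic.\<close>
    have "phi d A \<in> Gamma_hat d N \<longleftrightarrow> (\<forall>i j. (A - mat 1) $ i $ j \<in> principal_ideal d N)"
      unfolding phi_in_Gamma_hat[OF nz(1)] Gamma_iff phi_minus_one[symmetric]
        phi_entries_int_multiple[OF assms(1,2) nz(2)]
      using phi_in_Sp4_R[OF assms(1) A] by blast
    then show ?thesis
      using A congruent_mat_1_imp_ring_of_integers[OF assms(1,2) nz(2)] unfolding Lambda_def SL2_O_def by blast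
  qed
  then show "{A \<in> SL2_C. phi d A \<in> Gamma_hat d N} = Lambda d N"
    unfolding Lambda_def SL2_O_def by blast
qed

end
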